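(* Let $B$ be any abelian group and let $\{B_i\}$ be an inverse system of abelian groups indexed by $\mathbb{N}$ with surjective maps $f_i: B_{i+1} \to B_i$. Then the kernel of the natural map $\mathrm{Tor}(B,\varprojlim B_i) \to \varprojlim \mathrm{Tor}(B,B_i)$ is trivial.
   Context: $\mathrm{Tor}$ denotes $\mathrm{Tor}_1^{\mathbb{Z}}$. *)

theory Defs
  imports "HOL-Algebra.Free_Abelian_Groups"
begin

section \<open>Tensor products of abelian groups\<close>

definition tensor_relations ::
  "('a, 'm) monoid_scheme \<Rightarrow> ('b, 'n) monoid_scheme \<Rightarrow> ('a \<times> 'b \<Rightarrow>\<^sub>0 int) set" where
  "tensor_relations A X =
     {frag_of (a \<otimes>\<^bsub>A\<^esub> a', x) - frag_of (a, x) - frag_of (a', x) |a a' x.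
        a \<in> carrier A \<and> a' \<in> carrier A \<and> x \<in> carrier X} \<union>
     {frag_of (a, x \<otimes>\<^bsub>X\<^esub> x') - frag_of (a, x) - frag_of (a, x') |a x x'.
        a \<in> carrier A \<and> x \<in> carrier X \<and> x' \<in> carrier X}"

definition tensor_subgroup ::
  "('a, 'm) monoid_scheme \<Rightarrow> ('b, 'n) monoid_scheme \<Rightarrow> ('a \<times> 'b \<Rightarrow>\<^sub>0 int) set" where
  "tensor_subgroup A X =
     generate (free_Abelian_group (carrier A \<times> carrier X)) (tensor_relations A X)"

definition tensor_group ::
  "('a, 'm) monoid_scheme \<Rightarrow> ('b, 'n) monoid_scheme \<Rightarrow> ('a \<times> 'b \<Rightarrow>\<^sub>0 int) set monoid" where
  "tensor_group A X = free_Abelian_group (carrier A \<times> carrier X) Mod tensor_subgroup A X"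

definition pure_tensor ::
  "('a, 'm) monoid_scheme \<Rightarrow> ('b, 'n) monoid_scheme \<Rightarrow> 'a \<Rightarrow> 'b \<Rightarrow> ('a \<times> 'b \<Rightarrow>\<^sub>0 int) set" where
  "pure_tensor A X a x =
     tensor_subgroup A X #>\<^bsub>free_Abelian_group (carrier A \<times> carrier X)\<^esub> frag_of (a, x)"

text \<open>
  The map \<open>g \<otimes> h : A \<otimes> X \<rightarrow> A' \<otimes> X'\<close>, as the map induced on cosets by
  \<open>(a, x) \<mapsto> (g a, h x)\<close>. Only the target groups occur on the right-hand side.
\<close>

definition tensor_map ::
  "('a, 'm) monoid_scheme \<Rightarrow> ('b, 'n) monoid_scheme \<Rightarrow> ('c \<Rightarrow> 'a) \<Rightarrow> ('d \<Rightarrow> 'b)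
     \<Rightarrow> ('c \<times> 'd \<Rightarrow>\<^sub>0 int) set \<Rightarrow> ('a \<times> 'b \<Rightarrow>\<^sub>0 int) set" where
  "tensor_map A' X' g h C =
     the_elem ((\<lambda>c. tensor_subgroup A' X' #>\<^bsub>free_Abelian_group (carrier A' \<times> carrier X')\<^esub>
                      frag_extend (\<lambda>(a, x). frag_of (g a, h x)) c) ` C)"


section \<open>Tor over the integers\<close>

text \<open>
  \<open>Tor B X\<close> is the first homology of \<open>P \<otimes> X\<close> for the standard free resolution
  \<open>0 \<rightarrow> K \<rightarrow> \<int>[B] \<rightarrow> B \<rightarrow> 0\<close>, where \<open>\<int>[B]\<close> is the free abelian group on the underlying set
  of \<open>B\<close>. As the resolution vanishes in degrees above 1, this homology is the kernel of
  \<open>K \<otimes> X \<rightarrow> \<int>[B] \<otimes> X\<close>. Functoriality in \<open>X\<close> is given by \<open>id \<otimes> h\<close>.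
\<close>

definition resolution_free :: "('b, 'm) monoid_scheme \<Rightarrow> ('b \<Rightarrow>\<^sub>0 int) monoid" where
  "resolution_free B = free_Abelian_group (carrier B)"

definition resolution_aug :: "('b, 'm) monoid_scheme \<Rightarrow> ('b \<Rightarrow>\<^sub>0 int) \<Rightarrow> 'b" where
  "resolution_aug B c =
     finprod B (\<lambda>b. b [^]\<^bsub>B\<^esub> Poly_Mapping.lookup c b) (Poly_Mapping.keys c)"

definition resolution_ker :: "('b, 'm) monoid_scheme \<Rightarrow> ('b \<Rightarrow>\<^sub>0 int) monoid" where
  "resolution_ker B =
     (resolution_free B)\<lparr>carrier := kernel (resolution_free B) B (resolution_aug B)\<rparr>"

definition Tor ::
  "('b, 'm) monoid_scheme \<Rightarrow> ('c, 'n) monoid_scheme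
     \<Rightarrow> (('b \<Rightarrow>\<^sub>0 int) \<times> 'c \<Rightarrow>\<^sub>0 int) set monoid" where
  "Tor B X =
     (tensor_group (resolution_ker B) X)
       \<lparr>carrier := kernel (tensor_group (resolution_ker B) X) (tensor_group (resolution_free B) X)
                    (tensor_map (resolution_free B) X (\<lambda>k. k) (\<lambda>x. x))\<rparr>"

definition Tor_map ::
  "('b, 'm) monoid_scheme \<Rightarrow> ('c, 'n) monoid_scheme \<Rightarrow> ('d \<Rightarrow> 'c)
     \<Rightarrow> (('b \<Rightarrow>\<^sub>0 int) \<times> 'd \<Rightarrow>\<^sub>0 int) set \<Rightarrow> (('b \<Rightarrow>\<^sub>0 int) \<times> 'c \<Rightarrow>\<^sub>0 int) set" where
  "Tor_map B X' h = tensor_map (resolution_ker B) X' (\<lambda>k. k) h"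


section \<open>Inverse limits of towers\<close>

definition inverse_limit ::
  "(nat \<Rightarrow> ('a, 'm) monoid_scheme) \<Rightarrow> (nat \<Rightarrow> 'a \<Rightarrow> 'a) \<Rightarrow> (nat \<Rightarrow> 'a) monoid" where
  "inverse_limit G f =
     (product_group UNIV G)
       \<lparr>carrier := {x \<in> carrier (product_group UNIV G). \<forall>i. f i (x (Suc i)) = x i}\<rparr>"

text \<open>
  The natural map \<open>Tor B (lim G\<^sub>i) \<rightarrow> lim (Tor B G\<^sub>i)\<close>: its \<open>i\<close>-th component is induced by
  the projection \<open>lim G\<^sub>i \<rightarrow> G\<^sub>i\<close>.
\<close>

definition Tor_limit_map ::
  "('b, 'm) monoid_scheme \<Rightarrow> (nat \<Rightarrow> ('c, 'n) monoid_scheme)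
     \<Rightarrow> (('b \<Rightarrow>\<^sub>0 int) \<times> (nat \<Rightarrow> 'c) \<Rightarrow>\<^sub>0 int) set
     \<Rightarrow> nat \<Rightarrow> (('b \<Rightarrow>\<^sub>0 int) \<times> 'c \<Rightarrow>\<^sub>0 int) set" where
  "Tor_limit_map B G t = (\<lambda>i. Tor_map B (G i) (\<lambda>x. x i) t)"


section \<open>Well-definedness\<close>

lemma tensor_relations_subset:
  fixes A :: "('a, 'm) monoid_scheme" and X :: "('b, 'n) monoid_scheme"
  assumes "group A" "group X"
  shows "tensor_relations A X \<subseteq> carrier (free_Abelian_group (carrier A \<times> carrier X))"
proof -
  have *: "frag_of p - frag_of q - frag_of r \<in> carrier (free_Abelian_group S)"
    if "p \<in> S" "q \<in> S" "r \<in> S" for p q r and S :: "('a \<times> 'b) set"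
  proof -
    have "Poly_Mapping.keys (frag_of p - frag_of q - frag_of r) \<subseteq> {p} \<union> {q} \<union> {r}"
      using keys_diff[of "frag_of p - frag_of q" "frag_of r"] keys_diff[of "frag_of p" "frag_of q"]
      by (auto simp: keys_frag_of)
    then show ?thesis using that by auto
  qed
  show ?thesis
    unfolding tensor_relations_def
    by (safe; rule *) (use assms in \<open>auto simp: group.is_monoid monoid.m_closed\<close>)
qed

lemma subgroup_tensor_subgroup:
  assumes "group A" "group X"
  shows "subgroup (tensor_subgroup A X) (free_Abelian_group (carrier A \<times> carrier X))"
  unfolding tensor_subgroup_def
  by (intro group.generate_is_subgroup group_free_Abelian_group tensor_relations_subset assms)

lemma comm_group_tensor_group:
  assumes "group A" "group X"
  shows "comm_group (tensor_group A X)"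
  unfolding tensor_group_def
  by (intro comm_group.abelian_FactGroup abelian_free_Abelian_group subgroup_tensor_subgroup assms)

lemma normal_tensor_subgroup:
  assumes "group A" "group X"
  shows "tensor_subgroup A X \<lhd> free_Abelian_group (carrier A \<times> carrier X)"
  by (intro comm_group.normal_iff_subgroup[THEN iffD2] abelian_free_Abelian_group
      subgroup_tensor_subgroup assms)

lemma hom_frag_extend_tensor:
  assumes "g \<in> carrier A \<rightarrow> carrier A'" "h \<in> carrier X \<rightarrow> carrier X'"
  shows "frag_extend (\<lambda>(a, x). frag_of (g a, h x)) \<in>
     hom (free_Abelian_group (carrier A \<times> carrier X)) (free_Abelian_group (carrier A' \<times> carrier X'))"
proof (rule homI)
  fix c
  assume "c \<in> carrier (free_Abelian_group (carrier A \<times> carrier X))"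
  then have "Poly_Mapping.keys c \<subseteq> carrier A \<times> carrier X" by simp
  then show "frag_extend (\<lambda>(a, x). frag_of (g a, h x)) c
      \<in> carrier (free_Abelian_group (carrier A' \<times> carrier X'))"
    using assms keys_frag_extend[of "\<lambda>(a, x). frag_of (g a, h x)" c]
    by (fastforce simp: keys_frag_of)
qed (simp add: frag_extend_add)

lemma frag_extend_tensor_subgroup:
  assumes A: "group A" "group A'" "group X" "group X'"
    and g: "g \<in> hom A A'" and h: "h \<in> hom X X'" and n: "n \<in> tensor_subgroup A X"
  shows "frag_extend (\<lambda>(a, x). frag_of (g a, h x)) n \<in> tensor_subgroup A' X'"
proof -
  let ?F = "free_Abelian_group (carrier A \<times> carrier X)"
  let ?F' = "free_Abelian_group (carrier A' \<times> carrier X')"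
  let ?\<phi> = "frag_extend (\<lambda>(a, x). frag_of (g a, h x))"
  interpret S: subgroup "tensor_subgroup A' X'" ?F'
    using A by (simp add: subgroup_tensor_subgroup)
  have gh: "g \<in> carrier A \<rightarrow> carrier A'" "h \<in> carrier X \<rightarrow> carrier X'"
    using g h by (auto simp: hom_def)
  have rel: "?\<phi> r \<in> tensor_relations A' X'" if "r \<in> tensor_relations A X" for r
    using that g h gh unfolding tensor_relations_def
    by (fastforce simp: frag_extend_diff hom_mult)
  have rel': "?\<phi> r \<in> tensor_subgroup A' X'" if "r \<in> tensor_relations A X" for r
    unfolding tensor_subgroup_def using rel[OF that] by (rule generate.incl)
  from n show ?thesis
    unfolding tensor_subgroup_def[of A X]
  proof (induction rule: generate.induct)
    case one
    then show ?case using S.one_closed by simp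
  next
    case (incl r)
    then show ?case by (rule rel')
  next
    case (inv r)
    have "r \<in> carrier ?F" using inv tensor_relations_subset[OF A(1) A(3)] by blast
    then have "inv\<^bsub>?F\<^esub> r = - r" by simp
    moreover have "- ?\<phi> r \<in> tensor_subgroup A' X'"
      using S.m_inv_closed[OF rel'[OF inv]] S.mem_carrier[OF rel'[OF inv]] by simp
    ultimately show ?case by (simp add: frag_extend_minus)
  next
    case (eng r s)
    then show ?case using S.m_closed[OF eng.IH] by (simp add: frag_extend_add)
  qed
qed

lemma tensor_map_coset:
  assumes A: "group A" "group A'" "group X" "group X'"
    and g: "g \<in> hom A A'" and h: "h \<in> hom X X'"
    and c: "c \<in> carrier (free_Abelian_group (carrier A \<times> carrier X))"
  shows "tensor_map A' X' g h (tensor_subgroup A X #>\<^bsub>free_Abelian_group (carrier A \<times> carrier X)\<^esub> c) =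
    tensor_subgroup A' X' #>\<^bsub>free_Abelian_group (carrier A' \<times> carrier X')\<^esub>
      frag_extend (\<lambda>(a, x). frag_of (g a, h x)) c"
proof -
  let ?F = "free_Abelian_group (carrier A \<times> carrier X)"
  let ?F' = "free_Abelian_group (carrier A' \<times> carrier X')"
  let ?\<phi> = "frag_extend (\<lambda>(a, x). frag_of (g a, h x))"
  let ?N = "tensor_subgroup A X" and ?N' = "tensor_subgroup A' X'"
  have gh: "g \<in> carrier A \<rightarrow> carrier A'" "h \<in> carrier X \<rightarrow> carrier X'"
    using g h by (auto simp: hom_def)
  note \<phi> = hom_frag_extend_tensor[OF gh]
  have sub: "subgroup ?N ?F" "subgroup ?N' ?F'" using A by (simp_all add: subgroup_tensor_subgroup)
  have ne: "?N #>\<^bsub>?F\<^esub> c \<noteq> {}"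
    using subgroup.one_closed[OF sub(1)] by (auto simp: r_coset_def)
  have "?N' #>\<^bsub>?F'\<^esub> ?\<phi> d = ?N' #>\<^bsub>?F'\<^esub> ?\<phi> c" if d: "d \<in> ?N #>\<^bsub>?F\<^esub> c" for d
  proof -
    obtain n where n: "n \<in> ?N" "d = n + c" using d by (auto simp: r_coset_def)
    have n': "?\<phi> n \<in> ?N'" using A g h n(1) by (rule frag_extend_tensor_subgroup)
    have "?\<phi> d \<in> ?N' #>\<^bsub>?F'\<^esub> ?\<phi> c"
      using n' by (auto simp: r_coset_def n(2) frag_extend_add)
    then show ?thesis
      using group.repr_independence[OF group_free_Abelian_group _ _ sub(2)] hom_in_carrier[OF \<phi> c]
      by metis
  qed
  then have "(\<lambda>d. ?N' #>\<^bsub>?F'\<^esub> ?\<phi> d) ` (?N #>\<^bsub>?F\<^esub> c) = {?N' #>\<^bsub>?F'\<^esub> ?\<phi> c}"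
    using ne by blast
  then show ?thesis unfolding tensor_map_def by simp
qed

lemma tensor_map_pure_tensor:
  assumes "group A" "group A'" "group X" "group X'" "g \<in> hom A A'" "h \<in> hom X X'"
    and "a \<in> carrier A" "x \<in> carrier X"
  shows "tensor_map A' X' g h (pure_tensor A X a x) = pure_tensor A' X' (g a) (h x)"
  unfolding pure_tensor_def using assms by (subst tensor_map_coset) auto

lemma tensor_map_hom:
  assumes A: "group A" "group A'" "group X" "group X'"
    and g: "g \<in> hom A A'" and h: "h \<in> hom X X'"
  shows "tensor_map A' X' g h \<in> hom (tensor_group A X) (tensor_group A' X')"
proof -
  let ?F = "free_Abelian_group (carrier A \<times> carrier X)"
  let ?F' = "free_Abelian_group (carrier A' \<times> carrier X')"
  let ?\<phi> = "frag_extend (\<lambda>(a, x). frag_of (g a, h x))"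
  let ?N = "tensor_subgroup A X" and ?N' = "tensor_subgroup A' X'"
  interpret N: normal ?N ?F using A by (simp add: normal_tensor_subgroup)
  interpret N': normal ?N' ?F' using A by (simp add: normal_tensor_subgroup)
  have gh: "g \<in> carrier A \<rightarrow> carrier A'" "h \<in> carrier X \<rightarrow> carrier X'"
    using g h by (auto simp: hom_def)
  note \<phi> = hom_frag_extend_tensor[OF gh]
  note co = tensor_map_coset[OF A g h]
  show ?thesis
  proof (rule homI)
    fix C assume "C \<in> carrier (tensor_group A X)"
    then obtain c where c: "c \<in> carrier ?F" "C = ?N #>\<^bsub>?F\<^esub> c"
      unfolding tensor_group_def carrier_FactGroup by blast
    then show "tensor_map A' X' g h C \<in> carrier (tensor_group A' X')"
      unfolding tensor_group_def carrier_FactGroup c(2) co[OF c(1)]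
      using hom_in_carrier[OF \<phi> c(1)] by blast
  next
    fix C D assume "C \<in> carrier (tensor_group A X)" "D \<in> carrier (tensor_group A X)"
    then obtain c d where c: "c \<in> carrier ?F" "C = ?N #>\<^bsub>?F\<^esub> c"
      and d: "d \<in> carrier ?F" "D = ?N #>\<^bsub>?F\<^esub> d"
      unfolding tensor_group_def carrier_FactGroup by blast
    have cd: "c \<otimes>\<^bsub>?F\<^esub> d \<in> carrier ?F" using c(1) d(1) by (rule N.m_closed)
    have "tensor_map A' X' g h (C \<otimes>\<^bsub>tensor_group A X\<^esub> D) = ?N' #>\<^bsub>?F'\<^esub> ?\<phi> (c \<otimes>\<^bsub>?F\<^esub> d)"
      unfolding tensor_group_def mult_FactGroup c(2) d(2) N.rcos_sum[OF c(1) d(1)]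
      by (rule co[OF cd])
    also have "\<dots> = ?N' #>\<^bsub>?F'\<^esub> (?\<phi> c \<otimes>\<^bsub>?F'\<^esub> ?\<phi> d)"
      using hom_mult[OF \<phi> c(1) d(1)] by simp
    also have "\<dots> = (?N' #>\<^bsub>?F'\<^esub> ?\<phi> c) <#>\<^bsub>?F'\<^esub> (?N' #>\<^bsub>?F'\<^esub> ?\<phi> d)"
      using N'.rcos_sum[OF hom_in_carrier[OF \<phi> c(1)] hom_in_carrier[OF \<phi> d(1)]] by simp
    finally show "tensor_map A' X' g h (C \<otimes>\<^bsub>tensor_group A X\<^esub> D)
        = tensor_map A' X' g h C \<otimes>\<^bsub>tensor_group A' X'\<^esub> tensor_map A' X' g h D"
      by (simp add: tensor_group_def c(2) d(2) co[OF c(1)] co[OF d(1)])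
  qed
qed

lemma tensor_map_comp:
  assumes A: "group A" "group A'" "group A''" "group X" "group X'" "group X''"
    and g: "g \<in> hom A A'" "g' \<in> hom A' A''" and h: "h \<in> hom X X'" "h' \<in> hom X' X''"
    and C: "C \<in> carrier (tensor_group A X)"
  shows "tensor_map A'' X'' g' h' (tensor_map A' X' g h C)
    = tensor_map A'' X'' (\<lambda>a. g' (g a)) (\<lambda>x. h' (h x)) C"
proof -
  let ?F = "free_Abelian_group (carrier A \<times> carrier X)"
  obtain c where c: "c \<in> carrier ?F" "C = tensor_subgroup A X #>\<^bsub>?F\<^esub> c"
    using C unfolding tensor_group_def carrier_FactGroup by blast
  have gh: "g \<in> carrier A \<rightarrow> carrier A'" "h \<in> carrier X \<rightarrow> carrier X'"
    using g h by (auto simp: hom_def)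
  note \<phi>c = hom_in_carrier[OF hom_frag_extend_tensor[OF gh] c(1)]
  have g'': "(\<lambda>a. g' (g a)) \<in> hom A A''" "(\<lambda>x. h' (h x)) \<in> hom X X''"
    using hom_compose[OF g] hom_compose[OF h] by (simp_all add: o_def)
  have "(\<lambda>(a, x). frag_of (g a, h x)) = frag_of \<circ> (\<lambda>(a, x). (g a, h x))" by auto
  then have "frag_extend (\<lambda>(a, x). frag_of (g' a, h' x)) (frag_extend (\<lambda>(a, x). frag_of (g a, h x)) c)
      = frag_extend (\<lambda>(a, x). frag_of (g' (g a), h' (h x))) c"
    using frag_extend_compose[of "\<lambda>(a, x). frag_of (g' a, h' x)" "\<lambda>(a, x). (g a, h x)" c]
    by (simp add: o_def case_prod_unfold)
  then show ?thesis
    unfolding c(2)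
    by (simp only: tensor_map_coset[OF A(1,2,4,5) g(1) h(1) c(1)]
        tensor_map_coset[OF A(2,3,5,6) g(2) h(2) \<phi>c] tensor_map_coset[OF A(1,3,4,6) g'' c(1)])
qed

lemma resolution_aug_hom:
  assumes "comm_group B"
  shows "resolution_aug B \<in> hom (resolution_free B) B"
proof -
  interpret comm_group B by fact
  have ext: "resolution_aug B c = finprod B (\<lambda>b. b [^]\<^bsub>B\<^esub> Poly_Mapping.lookup c b) S"
    if "finite S" "Poly_Mapping.keys c \<subseteq> S" "S \<subseteq> carrier B" for c S
    unfolding resolution_aug_def
    using that by (intro finprod_mono_neutral_cong_left) (auto simp: in_keys_iff)
  show ?thesis
  proof (rule homI)
    fix c assume "c \<in> carrier (resolution_free B)"
    then show "resolution_aug B c \<in> carrier B"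
      by (auto simp: resolution_free_def resolution_aug_def intro!: finprod_closed)
  next
    fix c d assume "c \<in> carrier (resolution_free B)" "d \<in> carrier (resolution_free B)"
    then have cd: "Poly_Mapping.keys c \<subseteq> carrier B" "Poly_Mapping.keys d \<subseteq> carrier B"
      by (auto simp: resolution_free_def)
    let ?S = "Poly_Mapping.keys c \<union> Poly_Mapping.keys d"
    have "resolution_aug B (c + d) = finprod B (\<lambda>b. b [^]\<^bsub>B\<^esub> Poly_Mapping.lookup (c + d) b) ?S"
      using cd keys_add[of c d] by (intro ext) auto
    also have "\<dots> = finprod B (\<lambda>b. b [^]\<^bsub>B\<^esub> Poly_Mapping.lookup c b \<otimes>\<^bsub>B\<^esub> b [^]\<^bsub>B\<^esub> Poly_Mapping.lookup d b) ?S"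
      using cd by (intro finprod_cong') (auto simp: lookup_add int_pow_mult)
    also have "\<dots> = resolution_aug B c \<otimes>\<^bsub>B\<^esub> resolution_aug B d"
      using cd by (subst finprod_multf) (auto simp: ext[of ?S])
    finally show "resolution_aug B (c \<otimes>\<^bsub>resolution_free B\<^esub> d)
        = resolution_aug B c \<otimes>\<^bsub>B\<^esub> resolution_aug B d"
      by (simp add: resolution_free_def)
  qed
qed

lemma resolution_aug_epi:
  assumes "comm_group B"
  shows "resolution_aug B \<in> epi (resolution_free B) B"
proof -
  interpret comm_group B by fact
  have "resolution_aug B (frag_of b) = b" if "b \<in> carrier B" for b
    using that by (simp add: resolution_aug_def keys_frag_of)
  moreover have "frag_of b \<in> carrier (resolution_free B)" if "b \<in> carrier B" for b
    using that by (simp add: resolution_free_def)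
  ultimately have "carrier B \<subseteq> resolution_aug B ` carrier (resolution_free B)"
    by (metis image_eqI subsetI)
  then show ?thesis using resolution_aug_hom[OF assms] by (simp add: epi_iff_subset)
qed

lemma comm_group_resolution_free: "comm_group (resolution_free B)"
  by (simp add: resolution_free_def abelian_free_Abelian_group)

lemma comm_group_subgroup:
  assumes "comm_group G" "subgroup H G"
  shows "comm_group (G\<lparr>carrier := H\<rparr>)"
proof (rule group.group_comm_groupI)
  show "group (G\<lparr>carrier := H\<rparr>)"
    using subgroup.subgroup_is_group[OF assms(2) comm_group.axioms(2)[OF assms(1)]] .
  show "\<And>x y. x \<in> carrier (G\<lparr>carrier := H\<rparr>) \<Longrightarrow> y \<in> carrier (G\<lparr>carrier := H\<rparr>) \<Longrightarrow>
      x \<otimes>\<^bsub>G\<lparr>carrier := H\<rparr>\<^esub> y = y \<otimes>\<^bsub>G\<lparr>carrier := H\<rparr>\<^esub> x"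
    using subgroup.subset[OF assms(2)] comm_groupE(4)[OF assms(1)] by auto
qed

lemma comm_group_kernel:
  assumes "comm_group G" "group H" "h \<in> hom G H"
  shows "comm_group (G\<lparr>carrier := kernel G H h\<rparr>)"
proof -
  interpret group_hom G H h
    using assms by (simp add: group_hom_def group_hom_axioms_def comm_group.axioms)
  show ?thesis using comm_group_subgroup[OF assms(1) subgroup_kernel] .
qed

lemma comm_group_resolution_ker:
  assumes "comm_group B"
  shows "comm_group (resolution_ker B)"
  unfolding resolution_ker_def
  by (intro comm_group_kernel comm_group_resolution_free resolution_aug_hom assms
      comm_group.axioms(2)[OF assms])

lemma resolution_incl_hom: "(\<lambda>k. k) \<in> hom (resolution_ker B) (resolution_free B)"
  by (auto simp: hom_def resolution_ker_def kernel_def)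

lemma comm_group_Tor:
  assumes "comm_group B" "comm_group X"
  shows "comm_group (Tor B X)"
  unfolding Tor_def
  using assms
  by (intro comm_group_kernel comm_group_tensor_group tensor_map_hom resolution_incl_hom
      comm_group.axioms(2)[OF comm_group_resolution_ker] comm_group.axioms(2)[OF comm_group_resolution_free]
      comm_group.axioms(2)[OF comm_group_tensor_group])
    (auto simp: hom_def comm_group.axioms)

lemma Tor_map_hom:
  assumes B: "comm_group B" and X: "comm_group X" "comm_group X'" and h: "h \<in> hom X X'"
  shows "Tor_map B X' h \<in> hom (Tor B X) (Tor B X')"
proof -
  let ?K = "resolution_ker B" and ?F = "resolution_free B"
  have gr: "group ?K" "group ?F" "group X" "group X'"
    using comm_group_resolution_ker[OF B] comm_group_resolution_free[of B] X
    by (simp_all add: comm_group.axioms)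
  have idK: "(\<lambda>k. k) \<in> hom ?K ?K" and idF: "(\<lambda>k. k) \<in> hom ?F ?F"
    and idX: "(\<lambda>k. k) \<in> hom X X" "(\<lambda>k. k) \<in> hom X' X'"
    by (auto simp: hom_def)
  have th: "tensor_map ?K X' (\<lambda>k. k) h \<in> hom (tensor_group ?K X) (tensor_group ?K X')"
    and th': "tensor_map ?F X' (\<lambda>k. k) h \<in> hom (tensor_group ?F X) (tensor_group ?F X')"
    by (intro tensor_map_hom gr idK idF h)+
  have one: "tensor_map ?F X' (\<lambda>k. k) h \<one>\<^bsub>tensor_group ?F X\<^esub> = \<one>\<^bsub>tensor_group ?F X'\<^esub>"
    using hom_one[OF th'] gr by (simp add: comm_group_tensor_group comm_group.axioms)
  have "tensor_map ?F X' (\<lambda>k. k) (\<lambda>x. x) (tensor_map ?K X' (\<lambda>k. k) h t) = \<one>\<^bsub>tensor_group ?F X'\<^esub>"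
    if t: "t \<in> carrier (Tor B X)" for t
  proof -
    have t1: "t \<in> carrier (tensor_group ?K X)"
      and t2: "tensor_map ?F X (\<lambda>k. k) (\<lambda>x. x) t = \<one>\<^bsub>tensor_group ?F X\<^esub>"
      using t by (auto simp: Tor_def kernel_def)
    have "tensor_map ?F X' (\<lambda>k. k) (\<lambda>x. x) (tensor_map ?K X' (\<lambda>k. k) h t)
        = tensor_map ?F X' (\<lambda>k. k) h t"
      by (rule tensor_map_comp[OF gr(1) gr(1) gr(2) gr(3) gr(4) gr(4) idK resolution_incl_hom h idX(2) t1])
    also have "\<dots> = tensor_map ?F X' (\<lambda>k. k) h (tensor_map ?F X (\<lambda>k. k) (\<lambda>x. x) t)"
      by (rule tensor_map_comp[OF gr(1) gr(2) gr(2) gr(3) gr(3) gr(4) resolution_incl_hom idF idX(1) h t1,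
            symmetric])
    finally show ?thesis using t2 one by simp
  qed
  then show ?thesis
    using th by (auto simp: hom_def Tor_def Tor_map_def kernel_def)
qed

lemma subgroup_inverse_limit:
  assumes G: "\<And>i. group (G i)" and f: "\<And>i. f i \<in> hom (G (Suc i)) (G i)"
  shows "subgroup (carrier (inverse_limit G f)) (product_group UNIV G)"
proof -
  have P: "group (product_group UNIV G)" using G by simp
  show ?thesis
  proof (rule group.subgroupI[OF P])
    show "carrier (inverse_limit G f) \<subseteq> carrier (product_group UNIV G)"
      by (auto simp: inverse_limit_def)
    have "(\<lambda>i. \<one>\<^bsub>G i\<^esub>) \<in> carrier (inverse_limit G f)"
      using G hom_one[OF f] by (auto simp: inverse_limit_def group.is_monoid)
    then show "carrier (inverse_limit G f) \<noteq> {}" by blast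
  next
    fix x assume "x \<in> carrier (inverse_limit G f)"
    then have x: "\<And>i. x i \<in> carrier (G i)" "\<And>i. f i (x (Suc i)) = x i"
      by (auto simp: inverse_limit_def)
    have "f i (inv\<^bsub>G (Suc i)\<^esub> x (Suc i)) = inv\<^bsub>G i\<^esub> x i" for i
      using group_hom.hom_inv[of "G (Suc i)" "G i" "f i"] G f x
      by (simp add: group_hom_def group_hom_axioms_def)
    moreover have "inv\<^bsub>product_group UNIV G\<^esub> x = (\<lambda>i. inv\<^bsub>G i\<^esub> x i)"
      using inv_product_group[of x UNIV G] G x(1) by (auto simp: PiE_iff)
    ultimately show "inv\<^bsub>product_group UNIV G\<^esub> x \<in> carrier (inverse_limit G f)"
      using x G by (auto simp: inverse_limit_def)
  next
    fix x y assume "x \<in> carrier (inverse_limit G f)" "y \<in> carrier (inverse_limit G f)"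
    then show "x \<otimes>\<^bsub>product_group UNIV G\<^esub> y \<in> carrier (inverse_limit G f)"
      using G hom_mult[OF f]
      by (auto simp: inverse_limit_def PiE_iff group.is_monoid monoid.m_closed)
  qed
qed

lemma comm_group_inverse_limit:
  assumes "\<And>i. comm_group (G i)" "\<And>i. f i \<in> hom (G (Suc i)) (G i)"
  shows "comm_group (inverse_limit G f)"
proof -
  have G: "\<And>i. group (G i)" using assms(1) by (simp add: comm_group.axioms)
  have "comm_group (product_group UNIV G)"
    using assms(1) by (intro group.group_comm_groupI)
      (auto simp: G PiE_iff intro!: ext comm_monoid.m_comm comm_group.axioms(1))
  from comm_group_subgroup[OF this subgroup_inverse_limit[of G f]] G assms(2)
  show ?thesis by (simp add: inverse_limit_def)
qed

lemma inverse_limit_proj_hom: "(\<lambda>x. x i) \<in> hom (inverse_limit G f) (G i)"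
  by (auto simp: hom_def inverse_limit_def)

lemma Tor_limit_map_hom:
  assumes B: "comm_group B" and G: "\<And>i. comm_group (G i)" and f: "\<And>i. f i \<in> hom (G (Suc i)) (G i)"
  shows "Tor_limit_map B G \<in>
    hom (Tor B (inverse_limit G f)) (inverse_limit (\<lambda>i. Tor B (G i)) (\<lambda>i. Tor_map B (G i) (f i)))"
proof -
  let ?L = "inverse_limit G f" and ?K = "resolution_ker B"
  have L: "comm_group ?L" by (intro comm_group_inverse_limit G f)
  have gr: "group ?K" "group ?L" "\<And>i. group (G i)"
    using comm_group_resolution_ker[OF B] L G by (simp_all add: comm_group.axioms)
  have idK: "(\<lambda>k. k) \<in> hom ?K ?K" by (auto simp: hom_def)
  have hom: "Tor_map B (G i) (\<lambda>x. x i) \<in> hom (Tor B ?L) (Tor B (G i))" for i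
    by (intro Tor_map_hom B L G inverse_limit_proj_hom)
  have "Tor_map B (G i) (f i) (Tor_map B (G (Suc i)) (\<lambda>x. x (Suc i)) t) = Tor_map B (G i) (\<lambda>x. x i) t"
    if t: "t \<in> carrier (Tor B ?L)" for t i
  proof -
    let ?F = "free_Abelian_group (carrier ?K \<times> carrier ?L)"
    have t1: "t \<in> carrier (tensor_group ?K ?L)" using t by (auto simp: Tor_def kernel_def)
    then obtain c where c: "c \<in> carrier ?F" "t = tensor_subgroup ?K ?L #>\<^bsub>?F\<^esub> c"
      unfolding tensor_group_def carrier_FactGroup by blast
    have fp: "(\<lambda>x. f i (x (Suc i))) \<in> hom ?L (G i)"
      using hom_compose[OF inverse_limit_proj_hom[of "Suc i" G f] f[of i]] by (simp add: o_def)
    have "Tor_map B (G i) (f i) (Tor_map B (G (Suc i)) (\<lambda>x. x (Suc i)) t)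
        = tensor_map ?K (G i) (\<lambda>k. k) (\<lambda>x. f i (x (Suc i))) t"
      unfolding Tor_map_def
      by (rule tensor_map_comp[OF gr(1) gr(1) gr(1) gr(2) gr(3) gr(3) idK idK inverse_limit_proj_hom f t1])
    also have "\<dots> = tensor_map ?K (G i) (\<lambda>k. k) (\<lambda>x. x i) t"
    proof -
      have "frag_extend (\<lambda>(k, x). frag_of (k, f i (x (Suc i)))) c = frag_extend (\<lambda>(k, x). frag_of (k, x i)) c"
        using c(1) by (intro frag_extend_eq) (auto simp: inverse_limit_def)
      then show ?thesis
        unfolding c(2)
        by (simp add: tensor_map_coset[OF gr(1) gr(1) gr(2) gr(3) idK fp c(1)]
            tensor_map_coset[OF gr(1) gr(1) gr(2) gr(3) idK inverse_limit_proj_hom c(1)])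
    qed
    finally show ?thesis by (simp add: Tor_map_def)
  qed
  then show ?thesis
    using hom_in_carrier[OF hom] hom_mult[OF hom]
    by (intro homI) (auto simp: inverse_limit_def Tor_limit_map_def)
qed

end

theory Submission
  imports Defs
begin

text \<open>
  The kernel \<open>K\<close> of \<open>\<int>[B] \<rightarrow> B\<close> is a subgroup of a free abelian group, so it has a basis
  \<open>(e\<^sub>b)\<close> with coordinate functionals \<open>\<lambda>\<^sub>b : K \<rightarrow> \<int>\<close>. Every \<open>t \<in> K \<otimes> X\<close> is then
  \<open>\<Sum>\<^sub>b e\<^sub>b \<otimes> y\<^sub>b\<close> with \<open>y\<^sub>b = (\<lambda>\<^sub>b \<otimes> id) t\<close>. For \<open>X = lim B\<^sub>i\<close>, if \<open>t\<close> dies in every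
  \<open>K \<otimes> B\<^sub>i\<close>, then by naturality every component of every \<open>y\<^sub>b\<close> vanishes, so \<open>t = 0\<close>.
  Hence \<open>K \<otimes> lim B\<^sub>i \<rightarrow> \<Prod>\<^sub>i K \<otimes> B\<^sub>i\<close> is already injective, and Tor is a subgroup of its domain.
\<close>

section \<open>Coordinates on subgroups of free abelian groups\<close>

text \<open>Supplies the leading index of a nonzero formal sum, whose support is finite and
  nonempty.\<close>

lemma well_order_finite_greatest:
  assumes r: "well_order_on UNIV r" and "finite A" "A \<noteq> {}"
  shows "\<exists>m\<in>A. \<forall>a\<in>A. (a, m) \<in> r"
  using assms(2,3)
proof (induction rule: finite_ne_induct)
  case (singleton x)
  then show ?case
    using r by (auto simp: order_on_defs refl_on_def)
next
  case (insert x F)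
  have "trans r" "total r" "\<And>a. (a, a) \<in> r" using r by (auto simp: order_on_defs refl_on_def)
  then show ?case using insert.IH by (metis UNIV_I insert_iff total_on_def transE)
qed

lemma subgroup_free_Abelian_group_diff:
  assumes H: "subgroup H (free_Abelian_group S)" and "u \<in> H" "v \<in> H"
  shows "u - v \<in> H"
proof -
  have "- v \<in> H"
    using subgroup.m_inv_closed[OF H assms(3)] subgroup.mem_carrier[OF H assms(3)] by simp
  then show ?thesis using subgroup.m_closed[OF H assms(2), of "- v"] by simp
qed

lemma subgroup_free_Abelian_group_frag_extend:
  assumes H: "subgroup H (free_Abelian_group S)" and e: "\<And>b. b \<in> Poly_Mapping.keys c \<Longrightarrow> e b \<in> H"
  shows "frag_extend e c \<in> H"
proof -
  have "Poly_Mapping.keys c \<subseteq> {b. e b \<in> H}" using e by blast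
  then show ?thesis
  proof (rule free_Abelian_group_induct)
    show "frag_extend e 0 \<in> H" using subgroup.one_closed[OF H] by simp
  qed (simp_all add: frag_extend_diff subgroup_free_Abelian_group_diff[OF H])
qed

lemma subgroup_free_Abelian_group_frag_cmul:
  assumes H: "subgroup H (free_Abelian_group S)" and "u \<in> H"
  shows "frag_cmul n u \<in> H"
proof -
  \<comment> \<open>The multiple is an extension from the free group on one point, so closure under
    \<open>frag_extend\<close> applies.\<close>
  have "frag_extend (\<lambda>_. u) (frag_cmul n (frag_of ())) = frag_cmul n u"
    by (simp add: frag_extend_cmul)
  then show ?thesis
    using subgroup_free_Abelian_group_frag_extend[OF H, of "frag_cmul n (frag_of ())" "\<lambda>_. u"] assms by simp
qed

lemma lookup_frag_extend:
  "Poly_Mapping.lookup (frag_extend e c) b =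
     (\<Sum>i\<in>Poly_Mapping.keys c. Poly_Mapping.lookup c i * Poly_Mapping.lookup (e i) b)"
  by (simp add: frag_extend_def lookup_sum)

text \<open>Division with remainder: if an element of \<open>H\<close> supported in \<open>D\<close>
  has a coefficient at \<open>b\<close> of least nonzero absolute value, that coefficient divides
  all the others. If every coefficient at \<open>b\<close> vanishes, \<open>0\<close>
  serves.\<close>

lemma subgroup_free_Abelian_group_least_coeff:
  assumes H: "subgroup H (free_Abelian_group S)"
  shows "\<exists>e\<in>H. Poly_Mapping.keys e \<subseteq> D \<and>
    (\<forall>h\<in>H. Poly_Mapping.keys h \<subseteq> D \<longrightarrow> Poly_Mapping.lookup e b dvd Poly_Mapping.lookup h b)"
proof (cases "\<exists>h\<in>H. Poly_Mapping.keys h \<subseteq> D \<and> Poly_Mapping.lookup h b \<noteq> 0")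
  case False
  then show ?thesis using subgroup.one_closed[OF H] by (intro bexI[of _ 0]) auto
next
  case True
  define P where "P h \<longleftrightarrow> h \<in> H \<and> Poly_Mapping.keys h \<subseteq> D \<and> Poly_Mapping.lookup h b \<noteq> 0" for h
  have "\<exists>h. P h" using True unfolding P_def by blast
  then obtain e where e: "P e"
    and min: "\<And>h. P h \<Longrightarrow> nat \<bar>Poly_Mapping.lookup e b\<bar> \<le> nat \<bar>Poly_Mapping.lookup h b\<bar>"
    using ex_has_least_nat[of P _ "\<lambda>h. nat \<bar>Poly_Mapping.lookup h b\<bar>"] by metis
  have "Poly_Mapping.lookup e b dvd Poly_Mapping.lookup h b" if h: "h \<in> H" "Poly_Mapping.keys h \<subseteq> D" for h
  proof (rule ccontr)
    assume nd: "\<not> ?thesis"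
    let ?n = "Poly_Mapping.lookup e b"
    let ?h = "h - frag_cmul (Poly_Mapping.lookup h b div ?n) e"
    have eq: "Poly_Mapping.lookup ?h b = Poly_Mapping.lookup h b mod ?n"
      by (simp add: lookup_minus minus_div_mult_eq_mod)
    have "Poly_Mapping.keys ?h \<subseteq> D"
      using h(2) e keys_diff[of h "frag_cmul (Poly_Mapping.lookup h b div ?n) e"]
        keys_cmul[of "Poly_Mapping.lookup h b div ?n" e]
      unfolding P_def by blast
    then have "P ?h"
      using h e nd eq unfolding P_def
      by (auto intro!: subgroup_free_Abelian_group_diff[OF H] subgroup_free_Abelian_group_frag_cmul[OF H])
    from min[OF this] show False
      using e abs_mod_less[of ?n "Poly_Mapping.lookup h b"] unfolding eq P_def by linarith
  qed
  then show ?thesis using e unfolding P_def by blast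
qed

text \<open>
  The elements \<open>e b\<close> form a triangular generating family with respect to a well-order of the basis:
  \<open>e b\<close> lies in the span of the elements up to \<open>b\<close> and its leading coefficient there is
  the least possible one. Those with nonzero leading coefficient are a basis of \<open>H\<close>, and
  \<open>l\<close> is the coordinate map.
\<close>

lemma subgroup_free_Abelian_group_coordinates:
  fixes H :: "('a \<Rightarrow>\<^sub>0 int) set"
  assumes H: "subgroup H (free_Abelian_group S)"
  shows "\<exists>(e :: 'a \<Rightarrow> 'a \<Rightarrow>\<^sub>0 int) (l :: ('a \<Rightarrow>\<^sub>0 int) \<Rightarrow> 'a \<Rightarrow>\<^sub>0 int). range e \<subseteq> H \<and>
    (\<forall>h\<in>H. \<forall>h'\<in>H. l (h + h') = l h + l h') \<and> (\<forall>h\<in>H. frag_extend e (l h) = h)"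
proof -
  obtain r :: "'a rel" where r: "well_order_on UNIV r" using well_order_on by blast
  have r_antisym: "(a, b) \<in> r \<Longrightarrow> (b, a) \<in> r \<Longrightarrow> a = b"
    and r_wf: "wf (r - Id)" for a b
    using r by (auto simp: order_on_defs antisym_def)
  let ?D = "\<lambda>b. {a. (a, b) \<in> r}"
  obtain e where eH: "\<And>b. e b \<in> H" and eD: "\<And>b. Poly_Mapping.keys (e b) \<subseteq> ?D b"
    and dvd: "\<And>b h. h \<in> H \<Longrightarrow> Poly_Mapping.keys h \<subseteq> ?D b \<Longrightarrow>
      Poly_Mapping.lookup (e b) b dvd Poly_Mapping.lookup h b"
  proof -
    have "\<forall>b. \<exists>e. e \<in> H \<and> Poly_Mapping.keys e \<subseteq> ?D b \<and>
      (\<forall>h\<in>H. Poly_Mapping.keys h \<subseteq> ?D b \<longrightarrow> Poly_Mapping.lookup e b dvd Poly_Mapping.lookup h b)"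
      using subgroup_free_Abelian_group_least_coeff[OF H] by blast
    from choice[OF this] that show ?thesis by blast
  qed
  define J where "J = {b. Poly_Mapping.lookup (e b) b \<noteq> 0}"
  \<comment> \<open>Well-founded induction on the bound \<open>b\<close>: subtracting a multiple of
    \<open>e b\<close> clears the coefficient at \<open>b\<close>. A nonzero remainder is bounded by
    its own greatest index, strictly below \<open>b\<close>.\<close>
  have span: "\<exists>c. Poly_Mapping.keys c \<subseteq> J \<and> frag_extend e c = h"
    if "h \<in> H" "Poly_Mapping.keys h \<subseteq> ?D b" for h b
    using r_wf that
  proof (induction b arbitrary: h rule: wf_induct_rule)
    case (less b)
    obtain q where q: "Poly_Mapping.lookup h b = Poly_Mapping.lookup (e b) b * q"
      using dvd[OF less.prems] by (auto elim: dvdE)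
    \<comment> \<open>For \<open>b\<close> outside \<open>J\<close> the coefficient of
      \<open>h\<close> at \<open>b\<close> is \<open>0\<close> and \<open>q\<close> is arbitrary;
      choosing \<open>0\<close> keeps the coordinates supported in \<open>J\<close>.\<close>
    define q' where "q' = (if b \<in> J then q else 0)"
    have q': "Poly_Mapping.lookup h b = q' * Poly_Mapping.lookup (e b) b"
      using q by (auto simp: q'_def J_def)
    let ?h = "h - frag_cmul q' (e b)"
    have hH: "?h \<in> H"
      using less.prems(1) eH by (intro subgroup_free_Abelian_group_diff[OF H]
          subgroup_free_Abelian_group_frag_cmul[OF H])
    have hb: "b \<notin> Poly_Mapping.keys ?h" using q' by (simp add: in_keys_iff lookup_minus)
    have hD: "Poly_Mapping.keys ?h \<subseteq> ?D b"
      using less.prems(2) eD[of b] keys_diff[of h "frag_cmul q' (e b)"] keys_cmul[of q' "e b"]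
      by blast
    have "\<exists>c. Poly_Mapping.keys c \<subseteq> J \<and> frag_extend e c = ?h"
    proof (cases "?h = 0")
      case True
      then show ?thesis by (intro exI[of _ 0]) simp
    next
      case False
      then obtain m where m: "m \<in> Poly_Mapping.keys ?h" "Poly_Mapping.keys ?h \<subseteq> ?D m"
        using well_order_finite_greatest[OF r, of "Poly_Mapping.keys ?h"] by auto
      have "(m, b) \<in> r - Id" using m(1) hb hD by blast
      then show ?thesis using less.IH hH m(2) by blast
    qed
    then obtain c where c: "Poly_Mapping.keys c \<subseteq> J" "frag_extend e c = ?h" by blast
    let ?c = "c + frag_cmul q' (frag_of b)"
    have "Poly_Mapping.keys (frag_cmul q' (frag_of b)) \<subseteq> J"
      by (auto simp: q'_def in_keys_iff split: if_splits)
    then have "Poly_Mapping.keys ?c \<subseteq> J"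
      using c(1) keys_add[of c "frag_cmul q' (frag_of b)"] by blast
    moreover have "frag_extend e ?c = h"
      using c(2) by (simp add: frag_extend_add frag_extend_cmul)
    ultimately show ?case by blast
  qed
  have ex: "\<exists>c. Poly_Mapping.keys c \<subseteq> J \<and> frag_extend e c = h" if "h \<in> H" for h
  proof (cases "h = 0")
    case True
    then show ?thesis by (intro exI[of _ 0]) simp
  next
    case False
    then obtain m where "Poly_Mapping.keys h \<subseteq> ?D m"
      using well_order_finite_greatest[OF r, of "Poly_Mapping.keys h"] by auto
    then show ?thesis using span that by blast
  qed
  \<comment> \<open>Triangularity: at the greatest index \<open>m\<close> of \<open>c\<close> only
    \<open>e m\<close> contributes, so the coefficient there is a product of two nonzero
    integers.\<close>
  have inj0: "c = 0" if c: "Poly_Mapping.keys c \<subseteq> J" "frag_extend e c = 0" for c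
  proof (rule ccontr)
    assume "c \<noteq> 0"
    then obtain m where m: "m \<in> Poly_Mapping.keys c" "Poly_Mapping.keys c \<subseteq> ?D m"
      using well_order_finite_greatest[OF r, of "Poly_Mapping.keys c"] by auto
    have "Poly_Mapping.lookup (e i) m = 0" if "i \<in> Poly_Mapping.keys c" "i \<noteq> m" for i
      using that m(2) eD[of i] r_antisym[of i m] by (metis in_keys_iff mem_Collect_eq subsetD)
    then have "Poly_Mapping.lookup (frag_extend e c) m
        = Poly_Mapping.lookup c m * Poly_Mapping.lookup (e m) m"
      unfolding lookup_frag_extend using m(1) by (subst sum.remove[of _ m]) auto
    then show False using c m(1) by (auto simp: J_def in_keys_iff)
  qed
  have inj: "c = c'" if "Poly_Mapping.keys c \<subseteq> J" "Poly_Mapping.keys c' \<subseteq> J"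
    "frag_extend e c = frag_extend e c'" for c c'
    using inj0[of "c - c'"] that keys_diff[of c c'] by (auto simp: frag_extend_diff)
  obtain l where l: "\<And>h. h \<in> H \<Longrightarrow> Poly_Mapping.keys (l h) \<subseteq> J \<and> frag_extend e (l h) = h"
    using bchoice[of H "\<lambda>h c. Poly_Mapping.keys c \<subseteq> J \<and> frag_extend e c = h"] ex by blast
  \<comment> \<open>\<open>l\<close> was chosen pointwise; uniqueness of coordinates over
    \<open>J\<close> makes it additive.\<close>
  have l_add: "l (h + h') = l h + l h'" if "h \<in> H" "h' \<in> H" for h h'
  proof (rule inj)
    have "h + h' \<in> H" using subgroup.m_closed[OF H that] by simp
    then show "Poly_Mapping.keys (l (h + h')) \<subseteq> J" "frag_extend e (l (h + h')) = frag_extend e (l h + l h')"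
      using l that by (auto simp: frag_extend_add)
    show "Poly_Mapping.keys (l h + l h') \<subseteq> J"
      using l[OF that(1)] l[OF that(2)] keys_add[of "l h" "l h'"] by blast
  qed
  show ?thesis by (intro exI[of _ e] exI[of _ l]) (use eH l l_add in auto)
qed

section \<open>Additivity modulo the tensor relations\<close>

text \<open>Since \<open>\<phi>\<close> is additive modulo \<open>N\<close>, so is its composite
  with \<open>\<psi>\<close>, which therefore agrees modulo \<open>N\<close> with the linear
  extension of its values on generators. This serves to expand either factor of a tensor.\<close>

lemma hom_modulo_subgroup_frag_extend:
  assumes N: "subgroup N (free_Abelian_group T)" and G: "group G"
    and \<psi>: "\<psi> \<in> hom (free_Abelian_group S) G"
    and \<phi>: "\<And>x y. x \<in> carrier G \<Longrightarrow> y \<in> carrier G \<Longrightarrow> \<phi> (x \<otimes>\<^bsub>G\<^esub> y) - \<phi> x - \<phi> y \<in> N"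
    and c: "Poly_Mapping.keys c \<subseteq> S"
  shows "\<phi> (\<psi> c) - frag_extend (\<lambda>s. \<phi> (\<psi> (frag_of s))) c \<in> N"
  using c
proof (rule free_Abelian_group_induct)
  interpret G: group G by fact
  note diff = subgroup_free_Abelian_group_diff[OF N]
  have N0: "0 \<in> N" using subgroup.one_closed[OF N] by simp
  have \<psi>0: "\<psi> 0 = \<one>\<^bsub>G\<^esub>" using hom_one[OF \<psi>] G by simp
  \<comment> \<open>Near-additivity at the pair of identities puts the negative of
    \<open>\<phi> \<one>\<close> into \<open>N\<close>, hence also
    \<open>\<phi> \<one>\<close>.\<close>
  have "0 - (\<phi> (\<one>\<^bsub>G\<^esub> \<otimes>\<^bsub>G\<^esub> \<one>\<^bsub>G\<^esub>) - \<phi> \<one>\<^bsub>G\<^esub> - \<phi> \<one>\<^bsub>G\<^esub>) \<in> N" by (intro diff N0 \<phi>) auto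
  then show "\<phi> (\<psi> 0) - frag_extend (\<lambda>s. \<phi> (\<psi> (frag_of s))) 0 \<in> N" by (simp add: \<psi>0)
  fix x y
  let ?E = "frag_extend (\<lambda>s. \<phi> (\<psi> (frag_of s)))"
  assume xy: "Poly_Mapping.keys x \<subseteq> S" "Poly_Mapping.keys y \<subseteq> S"
    and IH: "\<phi> (\<psi> x) - ?E x \<in> N" "\<phi> (\<psi> y) - ?E y \<in> N"
  have xmy: "Poly_Mapping.keys (x - y) \<subseteq> S" using xy keys_diff[of x y] by blast
  then have "\<psi> x = \<psi> (x - y) \<otimes>\<^bsub>G\<^esub> \<psi> y" using hom_mult[OF \<psi>, of "x - y" y] xy by simp
  moreover have "\<psi> (x - y) \<in> carrier G" "\<psi> y \<in> carrier G"
    using hom_in_carrier[OF \<psi>] xmy xy by auto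
  ultimately have "\<phi> (\<psi> x) - \<phi> (\<psi> (x - y)) - \<phi> (\<psi> y) \<in> N" using \<phi> by metis
  from diff[OF diff[OF IH] this]
  show "\<phi> (\<psi> (x - y)) - ?E (x - y) \<in> N" by (simp add: frag_extend_diff algebra_simps)
qed (use subgroup.one_closed[OF N] in auto)

lemma tensor_subgroup_left:
  "a \<in> carrier A \<Longrightarrow> a' \<in> carrier A \<Longrightarrow> x \<in> carrier X \<Longrightarrow>
    frag_of (a \<otimes>\<^bsub>A\<^esub> a', x) - frag_of (a, x) - frag_of (a', x) \<in> tensor_subgroup A X"
  unfolding tensor_subgroup_def tensor_relations_def by (rule generate.incl) blast

lemma tensor_subgroup_right:
  "a \<in> carrier A \<Longrightarrow> x \<in> carrier X \<Longrightarrow> x' \<in> carrier X \<Longrightarrow>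
    frag_of (a, x \<otimes>\<^bsub>X\<^esub> x') - frag_of (a, x) - frag_of (a, x') \<in> tensor_subgroup A X"
  unfolding tensor_subgroup_def tensor_relations_def by (rule generate.incl) blast

section \<open>Integer functionals applied to tensors\<close>

lemma resolution_aug_frag_cmul:
  assumes "comm_group X" "x \<in> carrier X"
  shows "resolution_aug X (frag_cmul n (frag_of x)) = x [^]\<^bsub>X\<^esub> n"
proof -
  interpret comm_group X by fact
  have "Poly_Mapping.keys (frag_cmul n (frag_of x)) = {x}" if "n \<noteq> 0"
    using that by (auto simp: in_keys_iff split: if_splits)
  then show ?thesis using assms(2) by (cases "n = 0") (auto simp: resolution_aug_def)
qed

text \<open>The value stays a formal sum of elements of the second factor;
  \<open>resolution_aug\<close> evaluates it later. The coordinate expansion of tensors works with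
  this unevaluated form.\<close>

definition functional_contract :: "('a \<Rightarrow> int) \<Rightarrow> ('a \<times> 'b \<Rightarrow>\<^sub>0 int) \<Rightarrow> ('b \<Rightarrow>\<^sub>0 int)" where
  "functional_contract u = frag_extend (\<lambda>(a, x). frag_cmul (u a) (frag_of x))"

text \<open>
  For a homomorphism \<open>u : A \<rightarrow> \<int>\<close>, this is the map \<open>u \<otimes> id : A \<otimes> X \<rightarrow> \<int> \<otimes> X = X\<close>
  on representatives.
\<close>

definition functional_eval ::
  "('b, 'n) monoid_scheme \<Rightarrow> ('a \<Rightarrow> int) \<Rightarrow> ('a \<times> 'b \<Rightarrow>\<^sub>0 int) \<Rightarrow> 'b" where
  "functional_eval X u c = resolution_aug X (functional_contract u c)"

lemma functional_contract_hom:
  "functional_contract u \<in> hom (free_Abelian_group (S \<times> T)) (free_Abelian_group T)"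
proof (rule homI)
  fix c :: "'a \<times> 'b \<Rightarrow>\<^sub>0 int"
  assume "c \<in> carrier (free_Abelian_group (S \<times> T))"
  then have "Poly_Mapping.keys c \<subseteq> S \<times> T" by simp
  then show "functional_contract u c \<in> carrier (free_Abelian_group T)"
    unfolding functional_contract_def
    by (intro subgroup_free_Abelian_group_frag_extend[OF group.subgroup_self[OF group_free_Abelian_group]])
      (auto simp: in_keys_iff split: if_splits)
qed (simp add: functional_contract_def frag_extend_add)

lemma functional_eval_hom:
  assumes "comm_group X"
  shows "functional_eval X u \<in> hom (free_Abelian_group (S \<times> carrier X)) X"
  using hom_compose[OF functional_contract_hom, of "resolution_aug X" "carrier X" X u S]
    resolution_aug_hom[OF assms]
  by (simp add: functional_eval_def[abs_def] resolution_free_def o_def)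

lemma functional_eval_frag_of:
  assumes "comm_group X" "x \<in> carrier X"
  shows "functional_eval X u (frag_of (a, x)) = x [^]\<^bsub>X\<^esub> u a"
  using assms by (simp add: functional_eval_def functional_contract_def resolution_aug_frag_cmul)

text \<open>Relations in the first factor die because \<open>u\<close> is additive, those in the
  second because powers distribute over products in the commutative group \<open>X\<close>.
  Evaluation thus descends to the tensor product.\<close>

lemma functional_eval_tensor_subgroup:
  assumes A: "group A" and X: "comm_group X"
    and u: "\<And>a a'. a \<in> carrier A \<Longrightarrow> a' \<in> carrier A \<Longrightarrow> u (a \<otimes>\<^bsub>A\<^esub> a') = u a + u a'"
    and c: "c \<in> tensor_subgroup A X"
  shows "functional_eval X u c = \<one>\<^bsub>X\<^esub>"
proof -
  let ?F = "free_Abelian_group (carrier A \<times> carrier X)"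
  interpret X: comm_group X by fact
  interpret A: group A by fact
  interpret E: group_hom ?F X "functional_eval X u"
    using functional_eval_hom[OF X]
    by (simp add: group_hom_def group_hom_axioms_def X.is_group)
  have rel: "functional_eval X u (p - q - r) = \<one>\<^bsub>X\<^esub>"
    if "p - q - r \<in> carrier ?F" "q \<in> carrier ?F" "r \<in> carrier ?F"
      "functional_eval X u p = functional_eval X u q \<otimes>\<^bsub>X\<^esub> functional_eval X u r" for p q r
  proof -
    \<comment> \<open>Writing \<open>p\<close> as \<open>(p - q - r) + (q + r)\<close> turns the
      claim into a cancellation in \<open>X\<close>.\<close>
    have "functional_eval X u p = functional_eval X u ((p - q - r) \<otimes>\<^bsub>?F\<^esub> (q \<otimes>\<^bsub>?F\<^esub> r))"
      by simp
    also have "\<dots> = functional_eval X u (p - q - r) \<otimes>\<^bsub>X\<^esub> functional_eval X u p"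
      using that E.hom_mult E.G.m_closed by metis
    finally show ?thesis
      using that X.r_cancel_one' E.hom_closed X.m_closed by metis
  qed
  have sub: "tensor_relations A X \<subseteq> carrier ?F" by (intro tensor_relations_subset A X.is_group)
  have "tensor_relations A X \<subseteq> kernel ?F X (functional_eval X u)"
  proof
    fix t assume t: "t \<in> tensor_relations A X"
    then have tF: "t \<in> carrier ?F" using sub by blast
    have "functional_eval X u t = \<one>\<^bsub>X\<^esub>"
      using t tF unfolding tensor_relations_def
      by (auto intro!: rel simp del: carrier_free_Abelian_group_iff
          simp: functional_eval_frag_of[OF X] u X.int_pow_mult X.int_pow_distrib)
    then show "t \<in> kernel ?F X (functional_eval X u)" using tF unfolding kernel_def by blast
  qed
  then have "tensor_subgroup A X \<subseteq> kernel ?F X (functional_eval X u)"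
    unfolding tensor_subgroup_def
    by (rule E.G.generate_subgroup_incl[OF _ E.subgroup_kernel])
  then show ?thesis using c by (auto simp: kernel_def)
qed

text \<open>Both sides are homomorphisms in \<open>c\<close>, and they agree on generators because
  \<open>h\<close> preserves integer powers.\<close>

lemma functional_eval_natural:
  assumes X: "comm_group X" "comm_group X'" and h: "h \<in> hom X X'"
    and c: "Poly_Mapping.keys c \<subseteq> S \<times> carrier X"
  shows "h (functional_eval X u c) = functional_eval X' u (frag_extend (\<lambda>(a, x). frag_of (a, h x)) c)"
  using c
proof (rule free_Abelian_group_induct)
  let ?F = "free_Abelian_group (S \<times> carrier X)" and ?F' = "free_Abelian_group (S \<times> carrier X')"
  let ?p = "frag_extend (\<lambda>(a, x). frag_of (a, h x))"
  interpret X: comm_group X by fact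
  interpret X': comm_group X' by fact
  interpret h: group_hom X X' h
    using h by (simp add: group_hom_def group_hom_axioms_def X.is_group X'.is_group)
  interpret E: group_hom ?F X "functional_eval X u"
    using functional_eval_hom[OF X(1)] by (simp add: group_hom_def group_hom_axioms_def X.is_group)
  interpret E': group_hom ?F' X' "functional_eval X' u"
    using functional_eval_hom[OF X(2)] by (simp add: group_hom_def group_hom_axioms_def X'.is_group)
  show "h (functional_eval X u 0) = functional_eval X' u (?p 0)"
    using E.hom_one E'.hom_one by simp
  show "h (functional_eval X u (frag_of s)) = functional_eval X' u (?p (frag_of s))"
    if "s \<in> S \<times> carrier X" for s
    using that by (auto simp: functional_eval_frag_of X h.hom_int_pow)
  fix x y
  assume xy: "Poly_Mapping.keys x \<subseteq> S \<times> carrier X" "Poly_Mapping.keys y \<subseteq> S \<times> carrier X"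
    and IH: "h (functional_eval X u x) = functional_eval X' u (?p x)"
      "h (functional_eval X u y) = functional_eval X' u (?p y)"
  have p: "?p z \<in> carrier ?F'" if "Poly_Mapping.keys z \<subseteq> S \<times> carrier X" for z
    using that keys_frag_extend[of "\<lambda>(a, x). frag_of (a, h x)" z] by (fastforce simp: keys_frag_of)
  have sub: "x - y \<in> carrier ?F" using xy keys_diff[of x y] by auto
  have "h (functional_eval X u (x - y)) \<otimes>\<^bsub>X'\<^esub> h (functional_eval X u y) = h (functional_eval X u x)"
    using E.hom_mult[OF sub, of y] xy sub by (simp flip: h.hom_mult)
  moreover have "functional_eval X' u (?p (x - y)) \<otimes>\<^bsub>X'\<^esub> functional_eval X' u (?p y)
      = functional_eval X' u (?p x)"
    using E'.hom_mult[OF p p, of "x - y" y] xy sub by (simp add: frag_extend_diff)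
  ultimately show "h (functional_eval X u (x - y)) = functional_eval X' u (?p (x - y))"
    using IH X'.right_cancel[of "functional_eval X' u (?p y)" "h (functional_eval X u (x - y))"
        "functional_eval X' u (?p (x - y))"] E'.hom_closed[OF p] xy sub by simp
qed

section \<open>Coordinate expansion of tensors\<close>

text \<open>An interchange of finite sums: on a generator \<open>(k, x)\<close> both sides are the
  sum over \<open>b\<close> in \<open>T\<close> of \<open>lookup (l k) b\<close> times
  \<open>(e b, x)\<close>. The common set \<open>T\<close> lets the sum over \<open>b\<close> move
  outside.\<close>

lemma frag_extend_functional_contract:
  assumes T: "finite T" and c: "\<And>k x. (k, x) \<in> Poly_Mapping.keys c \<Longrightarrow> Poly_Mapping.keys (l k) \<subseteq> T"
  shows "frag_extend (\<lambda>(k, x). frag_extend (\<lambda>b. frag_of (e b, x)) (l k)) c =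
    (\<Sum>b\<in>T. frag_extend (\<lambda>x. frag_of (e b, x)) (functional_contract (\<lambda>k. Poly_Mapping.lookup (l k) b) c))"
proof -
  have "Poly_Mapping.keys c \<subseteq> {(k, x). Poly_Mapping.keys (l k) \<subseteq> T}" using c by auto
  then show ?thesis
  proof (rule free_Abelian_group_induct)
    fix s assume "s \<in> {(k, x). Poly_Mapping.keys (l k) \<subseteq> T}"
    then obtain k x where s: "s = (k, x)" "Poly_Mapping.keys (l k) \<subseteq> T" by auto
    have "frag_extend g (l k) = (\<Sum>b\<in>T. frag_cmul (Poly_Mapping.lookup (l k) b) (g b))" for g :: "_ \<Rightarrow> _ \<Rightarrow>\<^sub>0 int"
      unfolding frag_extend_def using T s(2)
      by (intro sum.mono_neutral_left) (auto simp: in_keys_iff)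
    then show "frag_extend (\<lambda>(k, x). frag_extend (\<lambda>b. frag_of (e b, x)) (l k)) (frag_of s) =
      (\<Sum>b\<in>T. frag_extend (\<lambda>x. frag_of (e b, x)) (functional_contract (\<lambda>k. Poly_Mapping.lookup (l k) b) (frag_of s)))"
      by (simp add: s functional_contract_def frag_extend_cmul)
  qed (simp_all add: functional_contract_def frag_extend_diff sum_subtractf)
qed

text \<open>
  Modulo the tensor relations, \<open>c \<equiv> \<Sum>\<^sub>b e b \<otimes> y\<^sub>b\<close> with \<open>y\<^sub>b\<close> the value at \<open>c\<close> of the \<open>b\<close>-th
  coordinate functional.
\<close>

lemma tensor_subgroup_coordinates_eval:
  assumes K: "group K" and X: "comm_group X"
    and e: "frag_extend e \<in> hom (free_Abelian_group UNIV) K"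
    and l: "\<And>k. k \<in> carrier K \<Longrightarrow> frag_extend e (l k) = k"
    and c: "Poly_Mapping.keys c \<subseteq> carrier K \<times> carrier X"
    and ev: "\<And>b. functional_eval X (\<lambda>k. Poly_Mapping.lookup (l k) b) c = \<one>\<^bsub>X\<^esub>"
  shows "c \<in> tensor_subgroup K X"
proof -
  let ?N = "tensor_subgroup K X"
  let ?g = "frag_extend (\<lambda>(k, x). frag_extend (\<lambda>b. frag_of (e b, x)) (l k))"
  interpret X: comm_group X by fact
  have N: "subgroup ?N (free_Abelian_group (carrier K \<times> carrier X))"
    by (intro subgroup_tensor_subgroup K X.is_group)
  note diff = subgroup_free_Abelian_group_diff[OF N]
  have N0: "0 \<in> ?N" using subgroup.one_closed[OF N] by simp
  have add: "u + v \<in> ?N" if "u \<in> ?N" "v \<in> ?N" for u v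
    using subgroup.m_closed[OF N that] by simp
  have eK: "e b \<in> carrier K" for b
    using hom_in_carrier[OF e, of "frag_of b"] by simp
  \<comment> \<open>Each first entry is \<open>k = frag_extend e (l k)\<close>; the relations in
    that factor split it into the \<open>e b\<close>.\<close>
  have cg: "c - ?g c \<in> ?N"
    using c
  proof (rule free_Abelian_group_induct)
    fix s assume "s \<in> carrier K \<times> carrier X"
    then obtain k x where s: "s = (k, x)" "k \<in> carrier K" "x \<in> carrier X" by auto
    show "frag_of s - ?g (frag_of s) \<in> ?N"
      using hom_modulo_subgroup_frag_extend[OF N K e, of "\<lambda>k. frag_of (k, x)" "l k"] s l
      by (simp add: tensor_subgroup_left)
  next
    fix x y assume "x - ?g x \<in> ?N" "y - ?g y \<in> ?N"
    then have "(x - ?g x) - (y - ?g y) \<in> ?N" by (rule diff)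
    then show "(x - y) - ?g (x - y) \<in> ?N" by (simp add: frag_extend_diff algebra_simps)
  qed (use N0 in simp)
  \<comment> \<open>Modulo the relations in the second factor, the term is \<open>e b\<close>
    tensored with the value of the \<open>b\<close>-th functional at \<open>c\<close>. By
    \<open>ev\<close> that value is the identity, and a tensor with the identity is trivial.\<close>
  have summand: "frag_extend (\<lambda>x. frag_of (e b, x)) (functional_contract (\<lambda>k. Poly_Mapping.lookup (l k) b) c) \<in> ?N"
    (is "?t \<in> _") for b
  proof -
    let ?d = "functional_contract (\<lambda>k. Poly_Mapping.lookup (l k) b) c"
    have d: "Poly_Mapping.keys ?d \<subseteq> carrier X"
      using hom_in_carrier[OF functional_contract_hom, of c "carrier K" "carrier X"] c by simp
    have "frag_of (e b, resolution_aug X ?d)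
        - frag_extend (\<lambda>s. frag_of (e b, resolution_aug X (frag_of s))) ?d \<in> ?N"
      using resolution_aug_hom[OF X] eK d
      by (intro hom_modulo_subgroup_frag_extend[OF N X.is_group])
        (auto simp: resolution_free_def tensor_subgroup_right)
    moreover have "frag_extend (\<lambda>s. frag_of (e b, resolution_aug X (frag_of s))) ?d = ?t"
      using d resolution_aug_frag_cmul[OF X, of _ 1] by (intro frag_extend_eq) auto
    moreover have "resolution_aug X ?d = \<one>\<^bsub>X\<^esub>" using ev[of b] by (simp add: functional_eval_def)
    ultimately have 1: "frag_of (e b, \<one>\<^bsub>X\<^esub>) - ?t \<in> ?N" by simp
    have "0 - (frag_of (e b, \<one>\<^bsub>X\<^esub> \<otimes>\<^bsub>X\<^esub> \<one>\<^bsub>X\<^esub>) - frag_of (e b, \<one>\<^bsub>X\<^esub>) - frag_of (e b, \<one>\<^bsub>X\<^esub>)) \<in> ?N"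
      by (intro diff N0 tensor_subgroup_right eK) auto
    then have "frag_of (e b, \<one>\<^bsub>X\<^esub>) \<in> ?N" by simp
    from diff[OF this 1] show ?thesis by simp
  qed
  let ?T = "\<Union>(k, x)\<in>Poly_Mapping.keys c. Poly_Mapping.keys (l k)"
  have sum: "(\<Sum>b\<in>T. frag_extend (\<lambda>x. frag_of (e b, x))
      (functional_contract (\<lambda>k. Poly_Mapping.lookup (l k) b) c)) \<in> ?N" for T
    by (induction T rule: infinite_finite_induct) (auto intro: add N0 summand)
  have "?g c \<in> ?N"
    by (subst frag_extend_functional_contract[of ?T]) (auto intro: sum)
  from add[OF cg this] show ?thesis by simp
qed

section \<open>Joint injectivity and the inverse limit\<close>

text \<open>By naturality, \<open>h i\<close> sends the value of a coordinate functional at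
  \<open>c\<close> to its value at the image of \<open>c\<close>, which is trivial by
  \<open>hc\<close>. Joint injectivity then makes every coordinate of \<open>c\<close>
  trivial.\<close>

lemma tensor_jointly_injective:
  fixes H :: "('a \<Rightarrow>\<^sub>0 int) set"
  assumes H: "subgroup H (free_Abelian_group S)" and K: "K = (free_Abelian_group S)\<lparr>carrier := H\<rparr>"
    and X: "comm_group X" and Y: "\<And>i. comm_group (Y i)"
    and h: "\<And>i. h i \<in> hom X (Y i)"
    and inj: "\<And>x. x \<in> carrier X \<Longrightarrow> (\<And>i. h i x = \<one>\<^bsub>Y i\<^esub>) \<Longrightarrow> x = \<one>\<^bsub>X\<^esub>"
    and c: "Poly_Mapping.keys c \<subseteq> carrier K \<times> carrier X"
    and hc: "\<And>i. frag_extend (\<lambda>(k, x). frag_of (k, h i x)) c \<in> tensor_subgroup K (Y i)"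
  shows "c \<in> tensor_subgroup K X"
proof -
  obtain e :: "'a \<Rightarrow> 'a \<Rightarrow>\<^sub>0 int" and l where e: "range e \<subseteq> H"
    and l: "\<And>k k'. k \<in> H \<Longrightarrow> k' \<in> H \<Longrightarrow> l (k + k') = l k + l k'"
    and el: "\<And>k. k \<in> H \<Longrightarrow> frag_extend e (l k) = k"
    using subgroup_free_Abelian_group_coordinates[OF H] by blast
  have gK: "group K" unfolding K by (rule subgroup.subgroup_is_group[OF H]) simp
  have eH: "e b \<in> H" for b using e by blast
  have eh: "frag_extend e \<in> hom (free_Abelian_group UNIV) K"
    by (rule homI) (auto simp: K frag_extend_add intro!: subgroup_free_Abelian_group_frag_extend[OF H] eH)
  show ?thesis
  proof (rule tensor_subgroup_coordinates_eval[OF gK X eh])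
    fix b
    let ?u = "\<lambda>k. Poly_Mapping.lookup (l k) b"
    show "functional_eval X ?u c = \<one>\<^bsub>X\<^esub>"
    proof (rule inj)
      show "functional_eval X ?u c \<in> carrier X"
        using hom_in_carrier[OF functional_eval_hom[OF X]] c by simp
      show "h i (functional_eval X ?u c) = \<one>\<^bsub>Y i\<^esub>" for i
        unfolding functional_eval_natural[OF X Y h c]
        by (rule functional_eval_tensor_subgroup[OF gK Y _ hc]) (simp add: K l lookup_add)
    qed
  qed (use el c in \<open>auto simp: K\<close>)
qed

theorem mainTheorem4:
  fixes B :: "('b, 'm) monoid_scheme"
    and Bs :: "nat \<Rightarrow> ('c, 'n) monoid_scheme"
    and f :: "nat \<Rightarrow> 'c \<Rightarrow> 'c"
  assumes "comm_group B"
    and "\<And>i. comm_group (Bs i)"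
    and "\<And>i. f i \<in> epi (Bs (Suc i)) (Bs i)"
  shows "kernel (Tor B (inverse_limit Bs f))
           (inverse_limit (\<lambda>i. Tor B (Bs i)) (\<lambda>i. Tor_map B (Bs i) (f i)))
           (Tor_limit_map B Bs)
         = {\<one>\<^bsub>Tor B (inverse_limit Bs f)\<^esub>}"
proof -
  let ?L = "inverse_limit Bs f" and ?K = "resolution_ker B"
  let ?F = "free_Abelian_group (carrier ?K \<times> carrier ?L)"
  let ?M = "inverse_limit (\<lambda>i. Tor B (Bs i)) (\<lambda>i. Tor_map B (Bs i) (f i))"
  have f: "f i \<in> hom (Bs (Suc i)) (Bs i)" for i using assms(3) by (simp add: epi_def)
  have L: "comm_group ?L" by (intro comm_group_inverse_limit assms(2) f)
  have M: "comm_group ?M"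
    by (intro comm_group_inverse_limit comm_group_Tor Tor_map_hom assms f)
  interpret \<tau>: group_hom "Tor B ?L" ?M "Tor_limit_map B Bs"
    using Tor_limit_map_hom[of B Bs f, OF assms(1,2) f] comm_group_Tor[OF assms(1) L] M
    by (simp add: group_hom_def group_hom_axioms_def comm_group.axioms)
  have gr: "group ?K" "group ?L" "\<And>i. group (Bs i)"
    using comm_group_resolution_ker[OF assms(1)] L assms(2) by (simp_all add: comm_group.axioms)
  interpret aug: group_hom "resolution_free B" B "resolution_aug B"
    using assms(1) comm_group_resolution_free[of B] resolution_aug_hom[OF assms(1)]
    by (simp add: group_hom_def group_hom_axioms_def comm_group.axioms)
  have idK: "(\<lambda>k. k) \<in> hom ?K ?K" by (auto simp: hom_def)
  have "t = \<one>\<^bsub>Tor B ?L\<^esub>"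
    if t: "t \<in> carrier (Tor B ?L)" and 0: "Tor_limit_map B Bs t = \<one>\<^bsub>?M\<^esub>" for t
  proof -
    have "t \<in> carrier (tensor_group ?K ?L)" using t by (auto simp: Tor_def kernel_def)
    then obtain c where c: "c \<in> carrier ?F" "t = tensor_subgroup ?K ?L #>\<^bsub>?F\<^esub> c"
      unfolding tensor_group_def carrier_FactGroup by blast
    \<comment> \<open>The projections of the limit are jointly injective, and \<open>?K\<close> is a
      subgroup of a free abelian group.\<close>
    have "c \<in> tensor_subgroup ?K ?L"
    proof (rule tensor_jointly_injective[OF aug.subgroup_kernel[unfolded resolution_free_def] _ L assms(2)])
      show "?K = (free_Abelian_group (carrier B))
          \<lparr>carrier := kernel (free_Abelian_group (carrier B)) B (resolution_aug B)\<rparr>"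
        by (simp add: resolution_ker_def resolution_free_def)
      show "(\<lambda>x. x i) \<in> hom ?L (Bs i)" for i by (rule inverse_limit_proj_hom)
      show "x = \<one>\<^bsub>?L\<^esub>" if "\<And>i. x i = \<one>\<^bsub>Bs i\<^esub>" for x
        using that by (auto simp: inverse_limit_def)
      show "Poly_Mapping.keys c \<subseteq> carrier ?K \<times> carrier ?L" using c(1) by simp
      fix i
      let ?Fi = "free_Abelian_group (carrier ?K \<times> carrier (Bs i))"
      let ?p = "frag_extend (\<lambda>(k, x). frag_of (k, x i)) c"
      \<comment> \<open>The identity of Tor is that of the ambient tensor product, namely the
        relation subgroup itself; a trivial component therefore puts \<open>?p\<close> into that
        subgroup.\<close>
      have "Tor_map B (Bs i) (\<lambda>x. x i) t = \<one>\<^bsub>Tor B (Bs i)\<^esub>"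
        using fun_cong[OF 0, of i] by (simp add: Tor_limit_map_def inverse_limit_def)
      then have eq: "tensor_subgroup ?K (Bs i) #>\<^bsub>?Fi\<^esub> ?p = tensor_subgroup ?K (Bs i)"
        using tensor_map_coset[OF gr(1) gr(1) gr(2) gr(3) idK inverse_limit_proj_hom c(1)]
        by (simp add: c(2) Tor_map_def Tor_def tensor_group_def one_FactGroup)
      have "?p \<in> carrier ?Fi"
        using hom_in_carrier[OF hom_frag_extend_tensor c(1), of "\<lambda>k. k" _ "\<lambda>x. x i"]
          inverse_limit_proj_hom[of i Bs f] by (auto simp: hom_def)
      then show "?p \<in> tensor_subgroup ?K (Bs i)"
        using group.coset_join1[OF _ eq] subgroup_tensor_subgroup[OF gr(1) gr(3)] by simp
    qed
    then show ?thesis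
      using group.coset_join2[OF _ c(1) subgroup_tensor_subgroup[OF gr(1,2)]]
      by (simp add: c(2) Tor_def tensor_group_def one_FactGroup)
  qed
  then show ?thesis
    unfolding kernel_def using \<tau>.hom_one \<tau>.G.one_closed by blast
qed

end
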